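(* Let $E$ be a (real or complex) Banach space. If $E^*$ has a Besselian Schauder frame and $E^{**}$ is separable, then $E$ is reflexive.
   Context: A Besselian Schauder frame for a Banach space $X$ is a sequence $((a_n,b_n^* ))_{n\ge1}$ in $X\times X^*$ such that (i) for every $x\in X$ the series $\sum_n b_n^*(x)a_n$ converges in norm to $x$, and (ii) there is $B>0$ with $\sum_{n=1}^\infty|b_n^*(x)||y^*(a_n)|\le B\|x\|_X\|y^*\|_{X^*}$ for all $x\in X$, $y^*\in X^*$. *)

theory Defs
  imports "HOL-Analysis.Analysis"
begin

section \<open>Real scalars\<close>

text \<open>
  The dual of a real normed space \<open>'a\<close> is the library type \<open>'a \<Rightarrow>\<^sub>L real\<close>, with the operator norm.
  Frames are indexed from 0.
\<close>

definition besselian_schauder_frame ::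
  "(nat \<Rightarrow> 'a::banach) \<Rightarrow> (nat \<Rightarrow> 'a \<Rightarrow>\<^sub>L real) \<Rightarrow> bool" where
  "besselian_schauder_frame a b \<longleftrightarrow>
     (\<forall>x. (\<lambda>n. blinfun_apply (b n) x *\<^sub>R a n) sums x) \<and>
     (\<exists>B>0. \<forall>x. \<forall>y :: 'a \<Rightarrow>\<^sub>L real.
        summable (\<lambda>n. \<bar>blinfun_apply (b n) x\<bar> * \<bar>blinfun_apply y (a n)\<bar>) \<and>
        (\<Sum>n. \<bar>blinfun_apply (b n) x\<bar> * \<bar>blinfun_apply y (a n)\<bar>) \<le> B * norm x * norm y)"

lift_definition bidual_embedding :: "'a::real_normed_vector \<Rightarrow> (('a \<Rightarrow>\<^sub>L real) \<Rightarrow>\<^sub>L real)"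
  is "\<lambda>x f. blinfun_apply f x"
  by (rule blinfun.bounded_linear_left)

definition reflexive_space :: "'a::real_normed_vector itself \<Rightarrow> bool" where
  "reflexive_space _ \<longleftrightarrow> surj (bidual_embedding :: 'a \<Rightarrow> (('a \<Rightarrow>\<^sub>L real) \<Rightarrow>\<^sub>L real))"


section \<open>Complex normed and Banach spaces\<close>

text \<open>
  A complex normed space is a real normed space whose real scaling is the restriction of a
  complex scaling. The law \<open>1 *\<^sub>C x = x\<close> follows from \<open>scaleR_scaleC\<close>.
\<close>

class complex_normed_vector = real_normed_vector +
  fixes scaleC :: "complex \<Rightarrow> 'a \<Rightarrow> 'a" (infixr "*\<^sub>C" 75)
  assumes scaleC_add_right: "c *\<^sub>C (x + y) = c *\<^sub>C x + c *\<^sub>C y"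
    and scaleC_add_left: "(c + d) *\<^sub>C x = c *\<^sub>C x + d *\<^sub>C x"
    and scaleC_scaleC: "c *\<^sub>C (d *\<^sub>C x) = (c * d) *\<^sub>C x"
    and scaleR_scaleC: "r *\<^sub>R x = complex_of_real r *\<^sub>C x"
    and norm_scaleC: "norm (c *\<^sub>C x) = cmod c * norm x"

class complex_banach = complex_normed_vector + banach

instantiation complex :: complex_banach
begin

definition scaleC_complex :: "complex \<Rightarrow> complex \<Rightarrow> complex" where
  "scaleC_complex c x = c * x"

instance
  by standard (simp_all add: scaleC_complex_def algebra_simps norm_mult scaleR_conv_of_real)

end


section \<open>The dual of a complex normed space\<close>

definition bounded_clinear :: "('a::complex_normed_vector \<Rightarrow> 'b::complex_normed_vector) \<Rightarrow> bool" where
  "bounded_clinear f \<longleftrightarrow> bounded_linear f \<and> (\<forall>c x. f (c *\<^sub>C x) = c *\<^sub>C f x)"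

typedef (overloaded) 'a cdual = "{f :: 'a::complex_normed_vector \<Rightarrow> complex. bounded_clinear f}"
  morphisms cdual_apply CDual
  by (rule exI[of _ "\<lambda>_. 0"]) (simp add: bounded_clinear_def scaleC_complex_def)

setup_lifting type_definition_cdual

lemma bounded_clinearD: "bounded_clinear f \<Longrightarrow> bounded_linear f"
  by (simp add: bounded_clinear_def)

instantiation cdual :: (complex_normed_vector) complex_normed_vector
begin

lift_definition norm_cdual :: "'a cdual \<Rightarrow> real" is onorm .

lift_definition zero_cdual :: "'a cdual" is "\<lambda>_. 0"
  by (simp add: bounded_clinear_def scaleC_complex_def)

lift_definition plus_cdual :: "'a cdual \<Rightarrow> 'a cdual \<Rightarrow> 'a cdual" is "\<lambda>f g x. f x + g x"
  by (simp add: bounded_clinear_def bounded_linear_add scaleC_add_right)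

lift_definition uminus_cdual :: "'a cdual \<Rightarrow> 'a cdual" is "\<lambda>f x. - f x"
  by (simp add: bounded_clinear_def bounded_linear_minus scaleC_complex_def)

lift_definition minus_cdual :: "'a cdual \<Rightarrow> 'a cdual \<Rightarrow> 'a cdual" is "\<lambda>f g x. f x - g x"
  by (simp add: bounded_clinear_def bounded_linear_sub scaleC_complex_def right_diff_distrib)

lift_definition scaleR_cdual :: "real \<Rightarrow> 'a cdual \<Rightarrow> 'a cdual" is "\<lambda>r f x. r *\<^sub>R f x"
  by (auto simp: bounded_clinear_def scaleC_complex_def
      intro: bounded_linear_compose[OF bounded_linear_scaleR_right])

lift_definition scaleC_cdual :: "complex \<Rightarrow> 'a cdual \<Rightarrow> 'a cdual" is "\<lambda>c f x. c *\<^sub>C f x"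
  by (auto simp: bounded_clinear_def scaleC_complex_def
      intro: bounded_linear_compose[OF bounded_linear_mult_right])

definition dist_cdual :: "'a cdual \<Rightarrow> 'a cdual \<Rightarrow> real" where
  "dist_cdual f g = norm (f - g)"

definition sgn_cdual :: "'a cdual \<Rightarrow> 'a cdual" where
  "sgn_cdual f = scaleR (inverse (norm f)) f"

definition uniformity_cdual :: "('a cdual \<times> 'a cdual) filter" where
  "uniformity_cdual = (INF e\<in>{0<..}. principal {(f, g). dist f g < e})"

definition open_cdual :: "'a cdual set \<Rightarrow> bool" where
  "open_cdual S = (\<forall>f\<in>S. \<forall>\<^sub>F (f', g) in uniformity. f' = f \<longrightarrow> g \<in> S)"

instance
proof
  fix f g h :: "'a cdual" and r s :: real and c d :: complex
  show "f + g + h = f + (g + h)" "f + g = g + f" "0 + f = f" "- f + f = 0" "f - g = f + - g"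
    by (transfer; simp add: algebra_simps)+
  show "r *\<^sub>R (f + g) = r *\<^sub>R f + r *\<^sub>R g" "(r + s) *\<^sub>R f = r *\<^sub>R f + s *\<^sub>R f"
    "r *\<^sub>R s *\<^sub>R f = (r * s) *\<^sub>R f" "1 *\<^sub>R f = f"
    by (transfer; simp add: algebra_simps)+
  show "sgn f = scaleR (inverse (norm f)) f" by (rule sgn_cdual_def)
  show "dist f g = norm (f - g)" by (rule dist_cdual_def)
  show "(uniformity :: ('a cdual \<times> 'a cdual) filter) = (INF e\<in>{0<..}. principal {(x, y). dist x y < e})"
    by (rule uniformity_cdual_def)
  show "\<And>S. open S = (\<forall>x\<in>S. \<forall>\<^sub>F (x', y) in uniformity. x' = x \<longrightarrow> (y::'a cdual) \<in> S)"
    by (rule open_cdual_def)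
  show "(norm f = 0) = (f = 0)"
    by transfer (auto simp: fun_eq_iff dest!: bounded_clinearD dest: onorm_eq_0)
  show "norm (f + g) \<le> norm f + norm g"
    by transfer (auto dest!: bounded_clinearD intro: onorm_triangle)
  show "norm (r *\<^sub>R f) = \<bar>r\<bar> * norm f"
    by transfer (auto dest!: bounded_clinearD intro: onorm_scaleR)
  show "c *\<^sub>C (f + g) = c *\<^sub>C f + c *\<^sub>C g" "(c + d) *\<^sub>C f = c *\<^sub>C f + d *\<^sub>C f"
    "c *\<^sub>C d *\<^sub>C f = (c * d) *\<^sub>C f"
    by (transfer; simp add: algebra_simps scaleC_complex_def)+
  show "r *\<^sub>R f = complex_of_real r *\<^sub>C f"
    by transfer (simp add: scaleR_conv_of_real scaleC_complex_def)
  have le: "onorm (\<lambda>x. c *\<^sub>C F x) \<le> cmod c * onorm F" if "bounded_clinear F"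
    for c and F :: "'a \<Rightarrow> complex"
    by (rule onorm_bound)
      (auto simp: scaleC_complex_def norm_mult mult.assoc
        intro!: mult_left_mono onorm mult_nonneg_nonneg onorm_pos_le bounded_clinearD[OF that])
  show "norm (c *\<^sub>C f) = cmod c * norm f"
  proof (cases "c = 0")
    case True
    then show ?thesis by transfer (simp add: scaleC_complex_def onorm_zero)
  next
    case False
    show ?thesis
    proof (rule antisym)
      show "norm (c *\<^sub>C f) \<le> cmod c * norm f"
        by transfer (rule le)
      have "norm (inverse c *\<^sub>C (c *\<^sub>C f)) \<le> cmod (inverse c) * norm (c *\<^sub>C f)"
        by transfer (rule le, auto simp: bounded_clinear_def scaleC_complex_def
            intro: bounded_linear_compose[OF bounded_linear_mult_right])
      moreover have "inverse c *\<^sub>C (c *\<^sub>C f) = f"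
        using False by transfer (simp add: scaleC_complex_def fun_eq_iff field_simps)
      ultimately have "norm f \<le> inverse (cmod c) * norm (c *\<^sub>C f)"
        by (simp add: norm_inverse)
      then show "cmod c * norm f \<le> norm (c *\<^sub>C f)"
        using False by (simp add: field_simps)
    qed
  qed
qed

end

lemma bounded_linear_cdual_apply: "bounded_linear (cdual_apply f)"
  by transfer (rule bounded_clinearD)

lemma norm_cdual_apply_le: "cmod (cdual_apply f x) \<le> norm f * norm x"
  by transfer (rule onorm[OF bounded_clinearD])

lemma cdual_apply_scaleC: "cdual_apply f (c *\<^sub>C x) = c * cdual_apply f x"
  by transfer (simp add: bounded_clinear_def scaleC_complex_def)

instance cdual :: (complex_normed_vector) complex_banach
proof
  fix X :: "nat \<Rightarrow> 'a cdual"
  assume "Cauchy X"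
  define Y where "Y n = Blinfun (cdual_apply (X n))" for n
  have Y: "blinfun_apply (Y n) = cdual_apply (X n)" for n
    by (simp add: Y_def bounded_linear_Blinfun_apply bounded_linear_cdual_apply)
  have norm_eq: "norm (Y m - Y n) = norm (X m - X n)" for m n
    by (simp add: norm_blinfun.rep_eq norm_cdual.rep_eq minus_blinfun.rep_eq minus_cdual.rep_eq Y)
  have "Cauchy Y"
    using \<open>Cauchy X\<close> by (simp add: Cauchy_def dist_norm norm_eq)
  then obtain L where L: "Y \<longlonglongrightarrow> L"
    using Cauchy_convergent convergent_def by blast
  have lim: "(\<lambda>n. cdual_apply (X n) x) \<longlonglongrightarrow> blinfun_apply L x" for x
    using blinfun.tendsto[OF L tendsto_const, of x] by (simp add: Y)
  have "blinfun_apply L (c *\<^sub>C x) = c * blinfun_apply L x" for c x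
    using LIMSEQ_unique[OF lim[of "c *\<^sub>C x"]] tendsto_mult_left[OF lim[of x], of c]
    by (simp add: cdual_apply_scaleC)
  then have bcl: "bounded_clinear (blinfun_apply L)"
    by (simp add: bounded_clinear_def scaleC_complex_def blinfun.bounded_linear_right)
  define M where "M = CDual (blinfun_apply L)"
  have M: "cdual_apply M = blinfun_apply L"
    using bcl by (simp add: M_def CDual_inverse)
  have "norm (X n - M) = norm (Y n - L)" for n
    by (simp add: norm_blinfun.rep_eq norm_cdual.rep_eq minus_blinfun.rep_eq minus_cdual.rep_eq Y M)
  with L have "X \<longlonglongrightarrow> M"
    by (simp add: LIMSEQ_iff)
  then show "convergent X"
    by (auto simp: convergent_def)
qed


section \<open>Complex scalars\<close>

definition cbesselian_schauder_frame ::
  "(nat \<Rightarrow> 'a::complex_banach) \<Rightarrow> (nat \<Rightarrow> 'a cdual) \<Rightarrow> bool" where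
  "cbesselian_schauder_frame a b \<longleftrightarrow>
     (\<forall>x. (\<lambda>n. cdual_apply (b n) x *\<^sub>C a n) sums x) \<and>
     (\<exists>B>0. \<forall>x. \<forall>y :: 'a cdual.
        summable (\<lambda>n. cmod (cdual_apply (b n) x) * cmod (cdual_apply y (a n))) \<and>
        (\<Sum>n. cmod (cdual_apply (b n) x) * cmod (cdual_apply y (a n))) \<le> B * norm x * norm y)"

lift_definition cbidual_embedding :: "'a::complex_normed_vector \<Rightarrow> 'a cdual cdual"
  is "\<lambda>x f. cdual_apply f x"
  unfolding bounded_clinear_def
  by (auto simp: plus_cdual.rep_eq scaleR_cdual.rep_eq scaleC_cdual.rep_eq
      intro!: bounded_linear_intro[OF _ _ norm_cdual_apply_le[THEN order_trans]])

definition creflexive_space :: "'a::complex_normed_vector itself \<Rightarrow> bool" where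
  "creflexive_space _ \<longleftrightarrow> surj (cbidual_embedding :: 'a \<Rightarrow> 'a cdual cdual)"

end

theory Submission
  imports Defs
begin

text \<open>
  Put \<open>X = E\<^sup>*\<close>. The Besselian bound makes \<open>\<Sum> \<phi>(a\<^sub>n) b\<^sub>n\<close> (for \<open>\<phi> \<in> X\<^sup>*\<close>) and
  \<open>\<Sum> \<Phi>(b\<^sub>n) a\<^sub>n\<close> (for \<open>\<Phi> \<in> X\<^sup>*\<^sup>*\<close>) weakly unconditionally Cauchy. Both live in separable
  dual spaces, where a Baire-type argument upgrades this to norm convergence: the frame is shrinking
  and boundedly complete. If \<open>x\<close> is the sum of the second series, applying \<open>\<Phi>\<close> to the expansion
  \<open>\<phi> = \<Sum> \<phi>(a\<^sub>n) b\<^sub>n\<close> gives \<open>\<Phi>(\<phi>) = \<phi>(x)\<close>, so \<open>X\<close> and hence \<open>E\<close> is reflexive. Complex scalars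
  reduce to real ones, since \<open>f \<mapsto> Re f\<close> identifies the complex dual with the real dual; there
  \<open>a\<^sub>n, i a\<^sub>n\<close> with \<open>Re b\<^sub>n, Im b\<^sub>n\<close> form a real frame.
\<close>

section \<open>The Hahn-Banach theorem\<close>

text \<open>Homogeneity is asked only as an inequality: using it for \<open>inverse t\<close> as
  well gives equality, and inequalities pass easily to the infima formed below.\<close>

definition sublinear :: "('v::real_vector \<Rightarrow> real) \<Rightarrow> bool" where
  "sublinear p \<longleftrightarrow> (\<forall>x y. p (x + y) \<le> p x + p y) \<and> (\<forall>t>0. \<forall>x. p (t *\<^sub>R x) \<le> t * p x)"

lemma sublinear_add: "sublinear p \<Longrightarrow> p (x + y) \<le> p x + p y"
  by (simp add: sublinear_def)

lemma sublinear_scaleR_le: "sublinear p \<Longrightarrow> t > 0 \<Longrightarrow> p (t *\<^sub>R x) \<le> t * p x"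
  by (simp add: sublinear_def)

lemma sublinear_zero:
  assumes "sublinear p"
  shows "p 0 = 0"
  using sublinear_scaleR_le[OF assms, of 2 0] sublinear_scaleR_le[OF assms, of "1/2" 0] by simp

lemma sublinear_scaleR:
  assumes "sublinear p" "t \<ge> 0"
  shows "p (t *\<^sub>R x) = t * p x"
proof (cases "t = 0")
  case True
  then show ?thesis by (simp add: sublinear_zero[OF assms(1)])
next
  case False
  with assms have t: "t > 0" by simp
  have "p (inverse t *\<^sub>R (t *\<^sub>R x)) \<le> inverse t * p (t *\<^sub>R x)"
    using t by (intro sublinear_scaleR_le[OF assms(1)]) simp
  then have "t * p x \<le> p (t *\<^sub>R x)"
    using t by (simp add: field_simps)
  with sublinear_scaleR_le[OF assms(1) t, of x] show ?thesis by simp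
qed

lemma sublinear_minus_ge:
  assumes "sublinear p"
  shows "- p (- x) \<le> p x"
  using sublinear_add[OF assms, of x "- x"] by (simp add: sublinear_zero[OF assms])

text \<open>For sublinear \<open>p\<close> this is the largest sublinear functional below
  \<open>p\<close> whose value at \<open>- y\<close> is at most \<open>- p y\<close>. A linear
  functional below it must therefore be at least \<open>p y\<close> at \<open>y\<close>.\<close>

definition sublinear_shift :: "('v::real_vector \<Rightarrow> real) \<Rightarrow> 'v \<Rightarrow> 'v \<Rightarrow> real" where
  "sublinear_shift p y v = (INF t\<in>{0..}. p (v + t *\<^sub>R y) - t * p y)"

lemma sublinear_shift_le:
  assumes "sublinear p" "t \<ge> 0"
  shows "sublinear_shift p y v \<le> p (v + t *\<^sub>R y) - t * p y"
proof -
  \<comment> \<open>A lower bound independent of \<open>s\<close>, so the real infimum is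
    genuine.\<close>
  have "- p (- v) \<le> p (v + s *\<^sub>R y) - s * p y" if "s \<ge> 0" for s
    using sublinear_add[OF assms(1), of "v + s *\<^sub>R y" "- v"] sublinear_scaleR[OF assms(1) that, of y]
    by simp
  then have "bdd_below ((\<lambda>t. p (v + t *\<^sub>R y) - t * p y) ` {0..})"
    by (intro bdd_belowI[where m = "- p (- v)"]) auto
  with assms(2) show ?thesis
    unfolding sublinear_shift_def by (intro cINF_lower) auto
qed

lemma sublinear_shift_greatest:
  assumes "\<And>t. t \<ge> 0 \<Longrightarrow> c \<le> p (v + t *\<^sub>R y) - t * p y"
  shows "c \<le> sublinear_shift p y v"
  unfolding sublinear_shift_def by (rule cINF_greatest) (auto intro: assms)

lemma sublinear_sublinear_shift:
  assumes p: "sublinear p"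
  shows "sublinear (sublinear_shift p y)"
  unfolding sublinear_def
proof (intro conjI allI impI)
  fix u v
  \<comment> \<open>The parameters \<open>t\<close> and \<open>s\<close> of two competitors are
    merged into the competitor \<open>t + s\<close> for \<open>u + v\<close>.\<close>
  have *: "sublinear_shift p y (u + v) \<le> (p (u + t *\<^sub>R y) - t * p y) + (p (v + s *\<^sub>R y) - s * p y)"
    if "t \<ge> 0" "s \<ge> 0" for s t
    using sublinear_shift_le[OF p, of "t + s" y "u + v"] that
      sublinear_add[OF p, of "u + t *\<^sub>R y" "v + s *\<^sub>R y"]
    by (simp add: algebra_simps)
  have "sublinear_shift p y (u + v) - (p (u + t *\<^sub>R y) - t * p y) \<le> sublinear_shift p y v"
    if "t \<ge> 0" for t
    by (rule sublinear_shift_greatest) (use *[OF that] in \<open>simp add: algebra_simps\<close>)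
  then have "sublinear_shift p y (u + v) - sublinear_shift p y v \<le> sublinear_shift p y u"
    by (intro sublinear_shift_greatest) (simp add: algebra_simps)
  then show "sublinear_shift p y (u + v) \<le> sublinear_shift p y u + sublinear_shift p y v"
    by simp
next
  fix c :: real and v :: 'a
  assume c: "c > 0"
  have "sublinear_shift p y (c *\<^sub>R v) / c \<le> sublinear_shift p y v"
  proof (rule sublinear_shift_greatest)
    fix t :: real assume "t \<ge> 0"
    with c have "sublinear_shift p y (c *\<^sub>R v) \<le> p (c *\<^sub>R (v + t *\<^sub>R y)) - c * t * p y"
      using sublinear_shift_le[OF p, of "c * t" y "c *\<^sub>R v"] by (simp add: algebra_simps)
    also have "\<dots> \<le> c * (p (v + t *\<^sub>R y) - t * p y)"
      using sublinear_scaleR_le[OF p c, of "v + t *\<^sub>R y"] by (simp add: algebra_simps)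
    finally show "sublinear_shift p y (c *\<^sub>R v) / c \<le> p (v + t *\<^sub>R y) - t * p y"
      using c by (simp add: field_simps)
  qed
  then show "sublinear_shift p y (c *\<^sub>R v) \<le> c * sublinear_shift p y v"
    using c by (simp add: field_simps)
qed

lemma sublinear_shift_le_self:
  assumes "sublinear p"
  shows "sublinear_shift p y v \<le> p v"
  using sublinear_shift_le[OF assms, of 0 y v] by simp

lemma sublinear_shift_minus:
  assumes "sublinear p"
  shows "sublinear_shift p y (- y) \<le> - p y"
  using sublinear_shift_le[OF assms, of 1 y "- y"] sublinear_zero[OF assms] by simp

text \<open>Supplies the bounds for Zorn's lemma. The infimum is finite because every member is at
  least \<open>- p (- v)\<close> at \<open>v\<close>; it is subadditive because two members of a
  chain always have a common one below them, to which subadditivity applies.\<close>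

lemma sublinear_Inf_chain:
  fixes C :: "('v::real_vector \<Rightarrow> real) set"
  assumes C: "C \<noteq> {}" "\<And>q. q \<in> C \<Longrightarrow> sublinear q" "\<And>q. q \<in> C \<Longrightarrow> q \<le> p"
    and chain: "\<And>q r. q \<in> C \<Longrightarrow> r \<in> C \<Longrightarrow> q \<le> r \<or> r \<le> q"
  shows "sublinear (\<lambda>v. INF q\<in>C. q v)" "q \<in> C \<Longrightarrow> (\<lambda>v. INF q\<in>C. q v) \<le> q"
proof -
  let ?I = "\<lambda>v. INF q\<in>C. q v"
  have "- p (- v) \<le> q v" if "q \<in> C" for q v
    using sublinear_minus_ge[OF C(2)[OF that], of v] le_funD[OF C(3)[OF that], of "- v"] by simp
  then have lower: "?I v \<le> q v" if "q \<in> C" for q v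
    using that by (intro cINF_lower bdd_belowI[where m = "- p (- v)"]) auto
  then show "q \<in> C \<Longrightarrow> ?I \<le> q"
    by (simp add: le_fun_def)
  show "sublinear ?I"
    unfolding sublinear_def
  proof (intro conjI allI impI)
    fix u v
    have *: "?I (u + v) \<le> q u + r v" if q: "q \<in> C" and r: "r \<in> C" for q r
    proof -
      from chain[OF q r] obtain s where s: "s \<in> C" "s \<le> q" "s \<le> r"
        using q r by auto
      have "?I (u + v) \<le> s u + s v"
        using lower[OF s(1), of "u + v"] sublinear_add[OF C(2)[OF s(1)], of u v] by simp
      also have "\<dots> \<le> q u + r v"
        using le_funD[OF s(2), of u] le_funD[OF s(3), of v] by simp
      finally show ?thesis .
    qed
    have "?I (u + v) - q u \<le> ?I v" if "q \<in> C" for q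
      by (rule cINF_greatest[OF C(1)]) (use *[OF that] in \<open>simp add: algebra_simps\<close>)
    then have "?I (u + v) - ?I v \<le> ?I u"
      by (intro cINF_greatest[OF C(1)]) (simp add: algebra_simps)
    then show "?I (u + v) \<le> ?I u + ?I v" by simp
  next
    fix t :: real and v assume t: "t > 0"
    have "?I (t *\<^sub>R v) / t \<le> ?I v"
    proof (rule cINF_greatest[OF C(1)])
      fix q assume "q \<in> C"
      then have "?I (t *\<^sub>R v) \<le> t * q v"
        using lower[of q "t *\<^sub>R v"] sublinear_scaleR_le[OF C(2) t, of q v] by simp
      then show "?I (t *\<^sub>R v) / t \<le> q v" using t by (simp add: field_simps)
    qed
    then show "?I (t *\<^sub>R v) \<le> t * ?I v" using t by (simp add: field_simps)
  qed
qed

text \<open>A minimal sublinear functional coincides with each of its shifts, so it is odd.\<close>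

lemma Hahn_Banach_sublinear:
  fixes p :: "'v::real_vector \<Rightarrow> real"
  assumes p: "sublinear p"
  shows "\<exists>f. linear f \<and> (\<forall>v. f v \<le> p v)"
proof -
  define A where "A = {q. sublinear q \<and> q \<le> p}"
  \<comment> \<open>The order is reversed, so that a maximal element for \<open>P\<close> is a
    minimal sublinear functional.\<close>
  define P where "P = (\<lambda>q r :: 'v \<Rightarrow> real. r \<le> q)"
  have "\<exists>m\<in>A. \<forall>q\<in>A. P m q \<longrightarrow> q = m"
  proof (rule predicate_Zorn)
    show "partial_order_on A (relation_of P A)"
      by (rule partial_order_on_relation_ofI) (auto simp: P_def)
  next
    fix C assume C: "C \<in> Chains (relation_of P A)"
    then have CA: "C \<subseteq> A"
      by (auto simp: Chains_def relation_of_def)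
    have chain: "q \<le> r \<or> r \<le> q" if "q \<in> C" "r \<in> C" for q r
      using C that by (auto simp: Chains_def relation_of_def P_def)
    show "\<exists>u\<in>A. \<forall>a\<in>C. P a u"
    proof (cases "C = {}")
      case True
      with p show ?thesis by (auto simp: A_def)
    next
      case False
      let ?I = "\<lambda>v. INF q\<in>C. q v"
      have sub: "sublinear q" and le: "q \<le> p" if "q \<in> C" for q
        using CA that by (auto simp: A_def)
      have I: "sublinear ?I" "\<And>q. q \<in> C \<Longrightarrow> ?I \<le> q"
        by (rule sublinear_Inf_chain[OF False sub le chain]; assumption)+
      from False obtain q where "q \<in> C" by blast
      with I(2) le have "?I \<le> p" by (blast intro: order_trans)
      with I show ?thesis by (intro bexI[of _ ?I]) (auto simp: A_def P_def)
    qed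
  qed
  then obtain m where m: "sublinear m" "m \<le> p"
    and min: "\<And>q. sublinear q \<Longrightarrow> q \<le> p \<Longrightarrow> q \<le> m \<Longrightarrow> q = m"
    by (auto simp: A_def P_def)
  have "sublinear_shift m y = m" for y
  proof (rule min)
    show "sublinear_shift m y \<le> m"
      by (simp add: le_fun_def sublinear_shift_le_self[OF m(1)])
    then show "sublinear_shift m y \<le> p" using m(2) by (rule order_trans)
  qed (rule sublinear_sublinear_shift[OF m(1)])
  then have odd: "m (- y) = - m y" for y
    using sublinear_shift_minus[OF m(1), of y] sublinear_minus_ge[OF m(1), of y] by simp
  have "m (u + v) = m u + m v" for u v
    using sublinear_add[OF m(1), of u v] sublinear_add[OF m(1), of "- u" "- v"] odd[of "u + v"]
      odd[of u] odd[of v] by simp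
  moreover have "m (t *\<^sub>R v) = t * m v" for t v
  proof (cases "t \<ge> 0")
    case False
    then have "m ((- t) *\<^sub>R v) = - t * m v"
      by (intro sublinear_scaleR[OF m(1)]) simp
    with odd[of "t *\<^sub>R v"] show ?thesis by simp
  qed (rule sublinear_scaleR[OF m(1)])
  ultimately have "linear m" by (intro linearI) simp_all
  with m(2) show ?thesis by (auto simp: le_fun_def)
qed

section \<open>Distance to a subspace and its norming functionals\<close>

lemma sublinear_infdist:
  fixes S :: "'v::real_normed_vector set"
  assumes S: "subspace S"
  shows "sublinear (\<lambda>v. infdist v S)"
proof -
  have ne: "S \<noteq> {}" using subspace_0[OF S] by blast
  \<comment> \<open>The distance need not be attained, so both inequalities are proved up to an
    error \<open>e\<close>.\<close>
  have attain: "\<exists>s\<in>S. dist v s < infdist v S + e" if "e > 0" for v and e :: real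
    using cInf_lessD[of "dist v ` S" "infdist v S + e"] ne that by (auto simp: infdist_notempty)
  show ?thesis
    unfolding sublinear_def
  proof (intro conjI allI impI)
    fix u v :: 'v
    show "infdist (u + v) S \<le> infdist u S + infdist v S"
    proof (rule field_le_epsilon)
      fix e :: real assume "e > 0"
      then obtain s t where st: "s \<in> S" "dist u s < infdist u S + e/2"
        "t \<in> S" "dist v t < infdist v S + e/2"
        using attain[of "e/2"] by (metis half_gt_zero)
      have "infdist (u + v) S \<le> dist (u + v) (s + t)"
        using st by (intro infdist_le subspace_add[OF S])
      also have "\<dots> \<le> dist u s + dist v t" by (rule dist_triangle_add)
      finally show "infdist (u + v) S \<le> infdist u S + infdist v S + e" using st by simp
    qed
  next
    fix t :: real and v :: 'v assume t: "t > 0"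
    show "infdist (t *\<^sub>R v) S \<le> t * infdist v S"
    proof (rule field_le_epsilon)
      fix e :: real assume "e > 0"
      with t obtain s where s: "s \<in> S" "dist v s < infdist v S + e/t"
        using attain[of "e/t" v] by auto
      have "infdist (t *\<^sub>R v) S \<le> dist (t *\<^sub>R v) (t *\<^sub>R s)"
        using s by (intro infdist_le subspace_scale[OF S])
      also have "\<dots> = t * dist v s"
        using t by (simp add: dist_norm flip: scaleR_diff_right)
      also have "\<dots> \<le> t * (infdist v S + e/t)" using s t by (intro mult_left_mono) auto
      finally show "infdist (t *\<^sub>R v) S \<le> t * infdist v S + e" using t by (simp add: algebra_simps)
    qed
  qed
qed

text \<open>Dominating by the shift at \<open>y\<close> of the distance function forces the value at
  \<open>y\<close>. Domination by the distance itself gives vanishing on \<open>S\<close>, where it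
  is 0 and which is symmetric, and norm at most 1. With \<open>S\<close> trivial this yields norming
  functionals, with larger \<open>S\<close> annihilators.\<close>

theorem Hahn_Banach_infdist:
  fixes S :: "'v::real_normed_vector set"
  assumes S: "subspace S"
  obtains F :: "'v \<Rightarrow>\<^sub>L real" where
    "\<And>s. s \<in> S \<Longrightarrow> blinfun_apply F s = 0" "norm F \<le> 1" "blinfun_apply F y = infdist y S"
proof -
  let ?p = "\<lambda>v. infdist v S"
  note p = sublinear_infdist[OF S]
  obtain f where f: "linear f" and le: "\<And>v. f v \<le> sublinear_shift ?p y v"
    using Hahn_Banach_sublinear[OF sublinear_sublinear_shift[OF p]] by blast
  interpret linear f by fact
  have fp: "f v \<le> ?p v" for v
    using le[of v] sublinear_shift_le_self[OF p, of y v] by simp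
  have pn: "?p v \<le> norm v" for v
    using infdist_le[OF subspace_0[OF S], of v] by simp
  have abs: "\<bar>f v\<bar> \<le> norm v" for v
    using fp[of v] pn[of v] fp[of "- v"] pn[of "- v"] by (simp add: neg)
  have bl: "bounded_linear f"
    using abs by (intro bounded_linear_intro[where K = 1]) (auto simp: add scale)
  show ?thesis
  proof
    show "norm (Blinfun f) \<le> 1"
      using abs by (intro norm_blinfun_bound) (auto simp: bounded_linear_Blinfun_apply[OF bl])
    show "blinfun_apply (Blinfun f) s = 0" if "s \<in> S" for s
      using fp[of s] fp[of "- s"] that subspace_neg[OF S that]
      by (simp add: neg bounded_linear_Blinfun_apply[OF bl])
    show "blinfun_apply (Blinfun f) y = infdist y S"
      using fp[of y] le[of "- y"] sublinear_shift_minus[OF p, of y]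
      by (simp add: neg bounded_linear_Blinfun_apply[OF bl])
  qed
qed

section \<open>Unconditional convergence in separable duals\<close>

text \<open>One step of the diagonal construction. The sums over \<open>S\<close> and over
  \<open>S\<close> joined with the block \<open>{n..<m}\<close> differ by at least
  \<open>\<delta>\<close> in norm, so one of them is at least \<open>\<delta>/2\<close> away from
  \<open>d\<close>. A single vector \<open>x\<close> detects this, and once \<open>M\<close> makes
  the tail at \<open>x\<close> small, the choice of indices beyond \<open>M\<close> cannot undo
  it.\<close>

lemma noncauchy_avoid:
  fixes u :: "nat \<Rightarrow> ('e::real_normed_vector \<Rightarrow>\<^sub>L real)"
  assumes summ: "\<And>x. summable (\<lambda>n. \<bar>blinfun_apply (u n) x\<bar>)"
    and \<delta>: "\<delta> > 0" "\<delta> \<le> norm (sum u {n..<m})" and N: "N \<le> n"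
    and S: "S \<subseteq> {..<N}"
  shows "\<exists>T M. N \<le> M \<and> T \<subseteq> {..<M} \<and> T \<inter> {..<N} = S \<and>
    (\<forall>A g. A \<inter> {..<M} = T \<longrightarrow>
      (\<forall>x. blinfun_apply g x = (\<Sum>i. if i \<in> A then blinfun_apply (u i) x else 0)) \<longrightarrow>
      \<delta>/4 \<le> norm (g - d))"
proof -
  let ?F = "{n..<m}"
  have fin: "finite S" using S finite_subset by blast
  have disj: "S \<inter> ?F = {}" using S N by auto
  have "n < m" using \<delta> by (cases "n < m") auto
  have "\<exists>T\<in>{S, S \<union> ?F}. \<delta>/2 \<le> norm (sum u T - d)"
  proof (rule ccontr)
    assume "\<not> ?thesis"
    then have "norm (sum u (S \<union> ?F) - d) < \<delta>/2" "norm (sum u S - d) < \<delta>/2" by auto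
    then have "norm ((sum u (S \<union> ?F) - d) - (sum u S - d)) < \<delta>"
      using norm_triangle_ineq4[of "sum u (S \<union> ?F) - d" "sum u S - d"] by simp
    with \<delta> show False using fin disj by (simp add: sum.union_disjoint)
  qed
  then obtain T where T: "\<delta>/2 \<le> norm (sum u T - d)" "T = S \<or> T = S \<union> ?F" by auto
  have Tm: "T \<subseteq> {..<m}" and TN: "T \<inter> {..<N} = S"
    using T(2) S N \<open>n < m\<close> by auto
  \<comment> \<open>The norm need not be attained, hence the loss from \<open>\<delta>/2\<close> to
    \<open>\<delta>/3\<close>.\<close>
  obtain x where x: "\<delta>/3 * norm x < \<bar>blinfun_apply (sum u T - d) x\<bar>"
  proof (rule ccontr)
    assume "\<not> thesis"
    then have "norm (sum u T - d) \<le> \<delta>/3"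
      using that \<delta>(1) by (intro norm_blinfun_bound) (force simp: not_less)+
    with T(1) \<delta>(1) show False by simp
  qed
  then have "x \<noteq> 0" by auto
  let ?h = "\<lambda>n. \<bar>blinfun_apply (u n) x\<bar>"
  \<comment> \<open>The tail may use up the difference between \<open>\<delta>/3\<close> and the
    promised \<open>\<delta>/4\<close>.\<close>
  have "\<delta>/12 * norm x > 0" using \<delta>(1) \<open>x \<noteq> 0\<close> by simp
  from suminf_exist_split[OF this summ[of x]]
  obtain M0 where M0: "\<And>n. n \<ge> M0 \<Longrightarrow> norm (\<Sum>i. ?h (i + n)) < \<delta>/12 * norm x" by blast
  define M where "M = max M0 m"
  have "\<delta>/4 \<le> norm (g - d)"
    if A: "A \<inter> {..<M} = T"
      and g: "\<And>x. blinfun_apply g x = (\<Sum>i. if i \<in> A then blinfun_apply (u i) x else 0)" for A g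
  proof -
    let ?f = "\<lambda>i. if i \<in> A then blinfun_apply (u i) x else 0"
    have sf: "summable ?f"
      by (rule summable_comparison_test'[OF summ[of x], of 0]) simp
    have "(\<Sum>i<M. ?f i) = blinfun_apply (sum u T) x"
      using A by (simp add: sum.If_cases Int_commute blinfun.sum_left)
    then have "blinfun_apply g x - blinfun_apply (sum u T) x = (\<Sum>i. ?f (i + M))"
      using g[of x] suminf_split_initial_segment[OF sf, of M] by simp
    moreover have "\<bar>\<Sum>i. ?f (i + M)\<bar> \<le> (\<Sum>i. ?h (i + M))"
    proof -
      have "summable (\<lambda>i. ?h (i + M))" 
        by (rule summable_ignore_initial_segment[OF summ])
      then have "norm (\<Sum>i. ?f (i + M)) \<le> (\<Sum>i. ?h (i + M))"
        by (intro norm_suminf_le) auto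
      then show ?thesis by simp
    qed
    moreover have "(\<Sum>i. ?h (i + M)) < \<delta>/12 * norm x"
      using M0[of M] by (simp add: M_def)
    ultimately have "\<delta>/4 * norm x < \<bar>blinfun_apply (g - d) x\<bar>"
      using x unfolding blinfun.diff_left by linarith
    also have "\<dots> \<le> norm (g - d) * norm x"
      using norm_blinfun[of "g - d" x] by simp
    finally show ?thesis using \<open>x \<noteq> 0\<close> by simp
  qed
  with Tm TN N \<open>n < m\<close> show ?thesis
    by (intro exI[of _ T] exI[of _ M]) (auto simp: M_def)
qed

text \<open>
  If the series failed to converge, a diagonal choice of index sets would produce a weak-star sum
  over a subset of the indices that stays away from every member of a dense sequence.
\<close>

lemma summable_separable_dual:
  fixes u :: "nat \<Rightarrow> ('e::real_normed_vector \<Rightarrow>\<^sub>L real)"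
  assumes bound: "\<And>N x. (\<Sum>n<N. \<bar>blinfun_apply (u n) x\<bar>) \<le> K * norm x"
    and D: "countable D" "closure D = (UNIV :: ('e \<Rightarrow>\<^sub>L real) set)"
  shows "summable u"
proof (rule ccontr)
  have summ: "summable (\<lambda>n. \<bar>blinfun_apply (u n) x\<bar>)" for x
    by (rule summableI_nonneg_bounded[OF _ bound]) simp
  assume "\<not> summable u"
  then obtain \<delta> where \<delta>: "\<delta> > 0" "\<And>N. \<exists>n\<ge>N. \<exists>m. \<delta> \<le> norm (sum u {n..<m})"
    unfolding summable_Cauchy by (force simp: not_less)
  have "D \<noteq> {}" using D(2) by auto
  define d where "d = from_nat_into D"
  have d: "range d = D" using D(1) \<open>D \<noteq> {}\<close> by (simp add: d_def range_from_nat_into)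
  define avoid where "avoid k T M \<longleftrightarrow> (\<forall>A g. A \<inter> {..<M} = T \<longrightarrow>
      (\<forall>x. blinfun_apply g x = (\<Sum>i. if i \<in> A then blinfun_apply (u i) x else 0)) \<longrightarrow>
      \<delta>/4 \<le> norm (g - d k))" for k T M
  \<comment> \<open>A state \<open>(S, N)\<close> settles which indices below \<open>N\<close> are
    selected; step \<open>k\<close> extends the selection so that every completion stays away from
    \<open>d k\<close>.\<close>
  have "\<exists>f. \<forall>k. (case f k of (S, N) \<Rightarrow> S \<subseteq> {..<N::nat}) \<and>
    (case f k of (S, N) \<Rightarrow> case f (Suc k) of (T, M) \<Rightarrow>
       N \<le> M \<and> T \<inter> {..<N} = S \<and> avoid k T M)"
  proof (rule dependent_nat_choice)
    show "\<exists>x. case x of (S, N) \<Rightarrow> S \<subseteq> {..<N::nat}" by auto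
  next
    fix x :: "nat set \<times> nat" and k
    assume "case x of (S, N) \<Rightarrow> S \<subseteq> {..<N}"
    then obtain S N where x: "x = (S, N)" and S: "S \<subseteq> {..<N}" by (cases x) auto
    from \<delta>(2)[of N] obtain n m where "N \<le> n" "\<delta> \<le> norm (sum u {n..<m})" by blast
    from noncauchy_avoid[OF summ \<delta>(1) this(2,1) S, of "d k"]
    obtain T M where "N \<le> M" "T \<subseteq> {..<M}" "T \<inter> {..<N} = S" "avoid k T M"
      unfolding avoid_def by blast
    then show "\<exists>y. (case y of (S, N) \<Rightarrow> S \<subseteq> {..<N}) \<and>
      (case x of (S, N) \<Rightarrow> case y of (T, M) \<Rightarrow> N \<le> M \<and> T \<inter> {..<N} = S \<and> avoid k T M)"
      by (intro exI[of _ "(T, M)"]) (simp add: x)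
  qed
  then obtain f where f: "\<forall>k. (case f k of (S, N) \<Rightarrow> S \<subseteq> {..<N::nat}) \<and>
    (case f k of (S, N) \<Rightarrow> case f (Suc k) of (T, M) \<Rightarrow>
       N \<le> M \<and> T \<inter> {..<N} = S \<and> avoid k T M)" by blast
  define S N where "S k = fst (f k)" and "N k = snd (f k)" for k
  have sub: "S k \<subseteq> {..<N k}" and mono1: "N k \<le> N (Suc k)"
    and ext1: "S (Suc k) \<inter> {..<N k} = S k" and av: "avoid k (S (Suc k)) (N (Suc k))" for k
    using f by (auto simp: S_def N_def split_beta)
  have mono: "N j \<le> N k" if "j \<le> k" for j k
    using that by (rule lift_Suc_mono_le[of N, OF mono1])
  have ext: "S k \<inter> {..<N j} = S j" if "j \<le> k" for j k
    using that
  proof (induction k rule: dec_induct)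
    case base
    then show ?case using sub[of j] by auto
  next
    case (step k)
    then show ?case using ext1[of k] mono[of j k] by fastforce
  qed
  define A where "A = (\<Union>k. S k)"
  have A: "A \<inter> {..<N k} = S k" for k
  proof
    show "S k \<subseteq> A \<inter> {..<N k}" using sub[of k] by (auto simp: A_def)
    show "A \<inter> {..<N k} \<subseteq> S k"
    proof
      fix i assume "i \<in> A \<inter> {..<N k}"
      then obtain j where "i \<in> S j" "i < N k" by (auto simp: A_def)
      then show "i \<in> S k"
        using ext[of j k] ext[of k j] by (cases "j \<le> k") auto
    qed
  qed
  let ?f = "\<lambda>x i. if i \<in> A then blinfun_apply (u i) x else 0"
  have sf: "summable (?f x)" for x
    by (rule summable_comparison_test'[OF summ[of x], of 0]) simp
  \<comment> \<open>The series over \<open>A\<close> converges pointwise, and the uniform bound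
    \<open>K\<close> makes its sum a bounded functional. This is where it matters that the space is
    a dual.\<close>
  have "bounded_linear (\<lambda>x. \<Sum>i. ?f x i)"
  proof (rule bounded_linear_intro)
    fix x y :: 'e and r :: real
    have "(\<Sum>i. ?f (x + y) i) = (\<Sum>i. ?f x i + ?f y i)"
      by (intro suminf_cong) (simp add: blinfun.add_right)
    then show "(\<Sum>i. ?f (x + y) i) = (\<Sum>i. ?f x i) + (\<Sum>i. ?f y i)"
      by (simp add: suminf_add[OF sf sf])
    have "(\<Sum>i. ?f (r *\<^sub>R x) i) = (\<Sum>i. r *\<^sub>R ?f x i)"
      by (intro suminf_cong) (simp add: blinfun.scaleR_right)
    then show "(\<Sum>i. ?f (r *\<^sub>R x) i) = r *\<^sub>R (\<Sum>i. ?f x i)"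
      using suminf_mult[OF sf[of x], of r] by simp
    have "norm (\<Sum>i. ?f x i) \<le> (\<Sum>i. \<bar>blinfun_apply (u i) x\<bar>)"
      by (rule norm_suminf_le[OF _ summ]) simp
    also have "\<dots> \<le> norm x * K"
      using suminf_le_const[OF summ bound] by (simp add: mult.commute)
    finally show "norm (\<Sum>i. ?f x i) \<le> norm x * K" .
  qed
  from fun_cong[OF bounded_linear_Blinfun_apply[OF this]]
  obtain g where g: "\<And>x. blinfun_apply g x = (\<Sum>i. ?f x i)"
    by (rule that)
  have far: "\<delta>/4 \<le> dist (d k) g" for k
    using av[of k] A[of "Suc k"] g by (simp add: avoid_def dist_norm norm_minus_commute)
  have "g \<in> closure D" using D(2) by simp
  moreover have "\<delta>/4 > 0" using \<delta>(1) by simp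
  ultimately obtain y where "y \<in> D" "dist y g < \<delta>/4"
    unfolding closure_approachable by blast
  with far d show False by (metis imageE not_less)
qed

section \<open>Real scalars\<close>

lemma countable_dense_of_sums:
  fixes a :: "nat \<Rightarrow> 'a::real_normed_vector"
  assumes "\<And>x. (\<lambda>n. c x n *\<^sub>R a n) sums x"
  shows "\<exists>D. countable D \<and> closure D = (UNIV :: 'a set)"
proof -
  \<comment> \<open>Finite rational combinations. \<open>PiE\<close> fixes the coefficients outside
    \<open>{..<N}\<close>, which keeps the set of coefficient functions countable.\<close>
  define D where "D = (\<Union>N. (\<lambda>q. \<Sum>n<N. q n *\<^sub>R a n) ` (PiE {..<N} (\<lambda>_. \<rat>)))"
  have "countable D"
    unfolding D_def by (intro countable_UN countable_image) (simp_all add: countable_PiE countable_rat)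
  moreover have "x \<in> closure D" for x
    unfolding closure_approachable
  proof (intro allI impI)
    fix e :: real assume e: "e > 0"
    have "(\<lambda>N. \<Sum>n<N. c x n *\<^sub>R a n) \<longlonglongrightarrow> x"
      using assms by (simp add: sums_def)
    from metric_LIMSEQ_D[OF this, of "e/2"] e
    obtain N where N: "dist (\<Sum>n<N. c x n *\<^sub>R a n) x < e/2" by auto
    \<comment> \<open>With this accuracy each of the \<open>N\<close> terms is off by at most
      \<open>e / (2 * (N + 1))\<close>; the added ones keep the denominators positive.\<close>
    define \<eta> where "\<eta> n = e / (2 * (N + 1) * (norm (a n) + 1))" for n
    have \<eta>: "\<eta> n > 0" for n
      using e norm_ge_zero[of "a n"] by (simp add: \<eta>_def add_nonneg_pos)
    have "\<exists>q\<in>\<rat>. \<bar>q - c x n\<bar> < \<eta> n" for n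
    proof -
      obtain q where "q \<in> \<rat>" "c x n - \<eta> n < q" "q < c x n + \<eta> n"
        using Rats_dense_in_real[of "c x n - \<eta> n" "c x n + \<eta> n"] \<eta>[of n] by auto
      then show ?thesis by (intro bexI[of _ q]) auto
    qed
    then obtain q where q: "\<And>n. q n \<in> \<rat>" "\<And>n. \<bar>q n - c x n\<bar> < \<eta> n" by metis
    let ?y = "\<Sum>n<N. q n *\<^sub>R a n"
    have "?y = (\<Sum>n<N. restrict q {..<N} n *\<^sub>R a n)" by simp
    then have "?y \<in> D"
      unfolding D_def using q(1) by (intro UN_I[of N] image_eqI[of _ _ "restrict q {..<N}"]) auto
    moreover have "dist ?y x < e"
    proof -
      have "dist ?y (\<Sum>n<N. c x n *\<^sub>R a n) = norm (\<Sum>n<N. (q n - c x n) *\<^sub>R a n)"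
        by (simp add: dist_norm algebra_simps sum_subtractf)
      also have "\<dots> \<le> (\<Sum>n<N. e / (2 * (N + 1)))"
      proof (rule sum_norm_le)
        fix n
        have "norm ((q n - c x n) *\<^sub>R a n) \<le> \<eta> n * (norm (a n) + 1)"
          using q(2)[of n] \<eta>[of n] by (simp add: mult_mono)
        also have "\<dots> = e / (2 * (N + 1))"
          using add_nonneg_pos[OF norm_ge_zero[of "a n"] zero_less_one] by (simp add: \<eta>_def)
        finally show "norm ((q n - c x n) *\<^sub>R a n) \<le> e / (2 * (N + 1))" .
      qed
      also have "\<dots> \<le> e/2" using e by (simp add: field_simps)
      finally show ?thesis using N dist_triangle[of ?y x "\<Sum>n<N. c x n *\<^sub>R a n"] by simp
    qed
    ultimately show "\<exists>y\<in>D. dist y x < e" by blast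
  qed
  ultimately show ?thesis by auto
qed

section \<open>The canonical embedding into the bidual\<close>

lemma separable_space_euclidean_iff:
  "separable_space (euclidean :: 'a::topological_space topology) \<longleftrightarrow>
    (\<exists>D :: 'a set. countable D \<and> closure D = UNIV)"
  by (auto simp: separable_space_def)

lemma bidual_embedding_apply [simp]:
  "blinfun_apply (bidual_embedding x) f = blinfun_apply f x"
  by (simp add: bidual_embedding.rep_eq)

lemma norm_bidual_embedding:
  "norm (bidual_embedding (x :: 'a::real_normed_vector)) = norm x"
proof (rule antisym)
  show "norm (bidual_embedding x) \<le> norm x"
  proof (rule norm_blinfun_bound)
    show "norm (blinfun_apply (bidual_embedding x) f) \<le> norm x * norm f" for f
      using norm_blinfun[of f x] by (simp add: mult.commute)
  qed simp
  obtain F :: "'a \<Rightarrow>\<^sub>L real" where F: "norm F \<le> 1" "blinfun_apply F x = infdist x {0}"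
    using Hahn_Banach_infdist[OF subspace_single_0] by blast
  then have "norm x \<le> norm (bidual_embedding x) * norm F"
    using norm_blinfun[of "bidual_embedding x" F] by simp
  also have "\<dots> \<le> norm (bidual_embedding x)"
    using F(1) by (simp add: mult_left_le)
  finally show "norm x \<le> norm (bidual_embedding x)" .
qed

lemma bounded_linear_bidual_embedding: "bounded_linear bidual_embedding"
proof (rule bounded_linear_intro)
  show "norm (bidual_embedding x) \<le> norm x * 1" for x :: 'a
    by (simp add: norm_bidual_embedding)
qed (auto intro!: blinfun_eqI simp: blinfun.bilinear_simps)

lemma closed_range_bidual_embedding:
  "closed (range (bidual_embedding :: 'a::banach \<Rightarrow> _))"
proof -
  have "complete (range (bidual_embedding :: 'a \<Rightarrow> _))"
    by (rule complete_isometric_image[of 1])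
      (auto simp: norm_bidual_embedding complete_UNIV bounded_linear_bidual_embedding)
  then show ?thesis by (rule complete_imp_closed)
qed

text \<open>A functional on the bidual that annihilates the embedded space is, by reflexivity of the
  dual, evaluation at some \<open>x\<close> in the dual. This \<open>x\<close> vanishes at every
  vector, so it is 0. Hence every \<open>\<phi>\<close> has distance 0 from the range, which is
  closed.\<close>

lemma reflexive_space_predual:
  assumes "reflexive_space TYPE('a::banach \<Rightarrow>\<^sub>L real)"
  shows "reflexive_space TYPE('a)"
proof -
  let ?R = "range (bidual_embedding :: 'a \<Rightarrow> _)"
  have sub: "subspace ?R"
    by (intro linear_subspace_image bounded_linear.linear bounded_linear_bidual_embedding) simp
  have "\<phi> \<in> ?R" for \<phi>
  proof -
    obtain F where F: "\<And>s. s \<in> ?R \<Longrightarrow> blinfun_apply F s = 0" "blinfun_apply F \<phi> = infdist \<phi> ?R"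
      using Hahn_Banach_infdist[OF sub] by blast
    obtain x where x: "F = bidual_embedding x"
      using assms unfolding reflexive_space_def by (metis surjD)
    have "blinfun_apply x e = 0" for e
      using F(1)[of "bidual_embedding e"] by (simp add: x)
    then have "x = 0" by (intro blinfun_eqI) simp
    then have "infdist \<phi> ?R = 0"
      using F(2) by (simp add: x)
    then show ?thesis
      using in_closed_iff_infdist_zero[OF closed_range_bidual_embedding] by auto
  qed
  then show ?thesis by (auto simp: reflexive_space_def)
qed

section \<open>Reflexivity from a frame of the dual\<close>

lemma besselian_frame_partial_sums:
  assumes "besselian_schauder_frame a b"
  obtains B where "B > 0"
    "\<And>N x y. (\<Sum>n<N. \<bar>blinfun_apply (b n) x\<bar> * \<bar>blinfun_apply y (a n)\<bar>) \<le> B * norm x * norm y"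
proof -
  obtain B where B: "B > 0" and s: "\<And>x y.
      summable (\<lambda>n. \<bar>blinfun_apply (b n) x\<bar> * \<bar>blinfun_apply y (a n)\<bar>) \<and>
      (\<Sum>n. \<bar>blinfun_apply (b n) x\<bar> * \<bar>blinfun_apply y (a n)\<bar>) \<le> B * norm x * norm y"
    using assms unfolding besselian_schauder_frame_def by blast
  have "(\<Sum>n<N. \<bar>blinfun_apply (b n) x\<bar> * \<bar>blinfun_apply y (a n)\<bar>) \<le> B * norm x * norm y" for N x y
    using s[of x y] sum_le_suminf[of "\<lambda>n. \<bar>blinfun_apply (b n) x\<bar> * \<bar>blinfun_apply y (a n)\<bar>" "{..<N}"]
    by fastforce
  with B show ?thesis using that by blast
qed

theorem dual_frame_imp_reflexive:
  fixes a :: "nat \<Rightarrow> ('a::banach \<Rightarrow>\<^sub>L real)"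
  assumes frame: "besselian_schauder_frame a b"
    and sep: "separable_space (euclidean :: (('a \<Rightarrow>\<^sub>L real) \<Rightarrow>\<^sub>L real) topology)"
  shows "reflexive_space TYPE('a)"
proof (rule reflexive_space_predual)
  obtain B where B: "B > 0"
    "\<And>N x y. (\<Sum>n<N. \<bar>blinfun_apply (b n) x\<bar> * \<bar>blinfun_apply y (a n)\<bar>) \<le> B * norm x * norm y"
    using besselian_frame_partial_sums[OF frame] by blast
  have expand: "(\<lambda>n. blinfun_apply (b n) x *\<^sub>R a n) sums x" for x
    using frame by (simp add: besselian_schauder_frame_def)
  \<comment> \<open>Separability of the dual comes from the frame expansion; that of the bidual is
    the hypothesis.\<close>
  obtain D where D: "countable D" "closure D = (UNIV :: ('a \<Rightarrow>\<^sub>L real) set)"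
    using countable_dense_of_sums[OF expand] by blast
  obtain D' where D': "countable D'" "closure D' = (UNIV :: (('a \<Rightarrow>\<^sub>L real) \<Rightarrow>\<^sub>L real) set)"
    using sep by (auto simp: separable_space_euclidean_iff)
  have shrinking: "(\<lambda>n. blinfun_apply \<phi> (a n) *\<^sub>R b n) sums \<phi>" for \<phi>
  proof -
    let ?u = "\<lambda>n. blinfun_apply \<phi> (a n) *\<^sub>R b n"
    have "summable ?u"
    proof (rule summable_separable_dual[OF _ D'])
      show "(\<Sum>n<N. \<bar>blinfun_apply (?u n) x\<bar>) \<le> (B * norm \<phi>) * norm x" for N x
        using B(2)[where N = N and x = x and y = \<phi>]
        by (simp add: blinfun.scaleR_left abs_mult mult_ac)
    qed
    then have u: "?u sums suminf ?u" by (rule summable_sums)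
    \<comment> \<open>Evaluating at \<open>x\<close> turns the series into \<open>\<phi>\<close>
      applied to the frame expansion of \<open>x\<close>.\<close>
    have "blinfun_apply (suminf ?u) x = blinfun_apply \<phi> x" for x
    proof (rule sums_unique2)
      show "(\<lambda>n. blinfun_apply (?u n) x) sums blinfun_apply (suminf ?u) x"
        by (rule bounded_linear.sums[OF blinfun.bounded_linear_left u])
      show "(\<lambda>n. blinfun_apply (?u n) x) sums blinfun_apply \<phi> x"
        using bounded_linear.sums[OF blinfun.bounded_linear_right[of \<phi>] expand[of x]]
        by (simp add: blinfun.bilinear_simps mult.commute)
    qed
    then have "suminf ?u = \<phi>" by (rule blinfun_eqI)
    with u show ?thesis by simp
  qed
  have boundedly_complete: "summable (\<lambda>n. blinfun_apply \<Phi> (b n) *\<^sub>R a n)" for \<Phi>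
  proof (rule summable_separable_dual[OF _ D])
    fix N and e :: 'a
    \<comment> \<open>The signs turn the sum of absolute values into the single value of
      \<open>\<Phi>\<close> at \<open>?w\<close>. The norm of \<open>?w\<close> is controlled by the
      Besselian bound for the functional \<open>bidual_embedding e\<close>.\<close>
    define t where "t n = sgn (blinfun_apply \<Phi> (b n) * blinfun_apply (a n) e)" for n
    let ?w = "\<Sum>n<N. (t n * blinfun_apply (a n) e) *\<^sub>R b n"
    have t: "\<bar>t n\<bar> \<le> 1" for n by (simp add: t_def abs_sgn_eq)
    have "norm ?w \<le> B * norm e"
    proof (rule norm_blinfun_bound)
      show "0 \<le> B * norm e" using B(1) by simp
      fix x
      have "norm (blinfun_apply ?w x) \<le> (\<Sum>n<N. \<bar>t n\<bar> * \<bar>blinfun_apply (b n) x\<bar> * \<bar>blinfun_apply (a n) e\<bar>)"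
        unfolding blinfun.sum_left
        by (rule order_trans[OF norm_sum]) (simp add: blinfun.scaleR_left abs_mult mult_ac)
      also have "\<dots> \<le> (\<Sum>n<N. 1 * \<bar>blinfun_apply (b n) x\<bar> * \<bar>blinfun_apply (bidual_embedding e) (a n)\<bar>)"
        using t unfolding bidual_embedding_apply by (intro sum_mono mult_right_mono) simp_all
      also have "\<dots> \<le> B * norm x * norm (bidual_embedding e)"
        using B(2)[where N = N and x = x and y = "bidual_embedding e"] by simp
      finally show "norm (blinfun_apply ?w x) \<le> B * norm e * norm x"
        by (simp add: norm_bidual_embedding mult_ac)
    qed
    then have "norm \<Phi> * norm ?w \<le> norm \<Phi> * (B * norm e)"
      by (rule mult_left_mono) simp
    moreover have "(\<Sum>n<N. \<bar>blinfun_apply (blinfun_apply \<Phi> (b n) *\<^sub>R a n) e\<bar>) = blinfun_apply \<Phi> ?w"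
      by (simp add: blinfun.bilinear_simps blinfun.sum_right t_def abs_sgn mult_ac)
    moreover have "blinfun_apply \<Phi> ?w \<le> norm \<Phi> * norm ?w"
      using norm_blinfun[of \<Phi> ?w] by simp
    ultimately show "(\<Sum>n<N. \<bar>blinfun_apply (blinfun_apply \<Phi> (b n) *\<^sub>R a n) e\<bar>) \<le> (norm \<Phi> * B) * norm e"
      by simp
  qed
  have "\<exists>x. \<Phi> = bidual_embedding x" for \<Phi> :: "(('a \<Rightarrow>\<^sub>L real) \<Rightarrow>\<^sub>L real) \<Rightarrow>\<^sub>L real"
  proof (intro exI blinfun_eqI)
    fix \<phi>
    \<comment> \<open>Both sides are the sum of one scalar series: \<open>\<Phi>\<close> applied to
      the expansion of \<open>\<phi>\<close>, and \<open>\<phi>\<close> applied to the series that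
      represents \<open>\<Phi>\<close>.\<close>
    show "blinfun_apply \<Phi> \<phi> = blinfun_apply (bidual_embedding (\<Sum>n. blinfun_apply \<Phi> (b n) *\<^sub>R a n)) \<phi>"
    proof (rule sums_unique2)
      show "(\<lambda>n. blinfun_apply \<phi> (a n) * blinfun_apply \<Phi> (b n)) sums blinfun_apply \<Phi> \<phi>"
        using bounded_linear.sums[OF blinfun.bounded_linear_right[of \<Phi>] shrinking[of \<phi>]]
        by (simp add: blinfun.bilinear_simps)
      show "(\<lambda>n. blinfun_apply \<phi> (a n) * blinfun_apply \<Phi> (b n)) sums
        blinfun_apply (bidual_embedding (\<Sum>n. blinfun_apply \<Phi> (b n) *\<^sub>R a n)) \<phi>"
        using bounded_linear.sums[OF blinfun.bounded_linear_right[of \<phi>] summable_sums[OF boundedly_complete[of \<Phi>]]]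
        by (simp add: blinfun.bilinear_simps mult.commute)
    qed
  qed
  then show "reflexive_space TYPE('a \<Rightarrow>\<^sub>L real)"
    unfolding reflexive_space_def surj_def by blast
qed

section \<open>Complex scalars\<close>

lemma cdual_eqI: "(\<And>x. cdual_apply f x = cdual_apply g x) \<Longrightarrow> f = g"
  by (metis cdual_apply_inject ext)

definition re_functional :: "'c::complex_normed_vector cdual \<Rightarrow> ('c \<Rightarrow>\<^sub>L real)" where
  "re_functional f = Blinfun (\<lambda>x. Re (cdual_apply f x))"

lemma re_functional_apply [simp]:
  "blinfun_apply (re_functional f) x = Re (cdual_apply f x)"
  by (simp add: re_functional_def bounded_linear_Blinfun_apply
      bounded_linear_compose[OF bounded_linear_Re bounded_linear_cdual_apply])

lemma norm_re_functional_le: "norm (re_functional f) \<le> norm f"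
proof (rule norm_blinfun_bound)
  show "norm (blinfun_apply (re_functional f) x) \<le> norm f * norm x" for x
    using abs_Re_le_cmod[of "cdual_apply f x"] norm_cdual_apply_le[of f x] by simp
qed simp

lemma bounded_linear_re_functional: "bounded_linear re_functional"
  by (rule bounded_linear_intro[where K = 1])
    (auto intro!: blinfun_eqI simp: norm_re_functional_le blinfun.bilinear_simps
      plus_cdual.rep_eq scaleR_cdual.rep_eq)

lemma re_functional_scaleC:
  "re_functional (c *\<^sub>C f) = Re c *\<^sub>R re_functional f + Im c *\<^sub>R re_functional (\<i> *\<^sub>C f)"
  by (rule blinfun_eqI)
    (simp add: blinfun.bilinear_simps scaleC_cdual.rep_eq scaleC_complex_def)

lemma scaleC_conv_scaleR:
  "c *\<^sub>C x = Re c *\<^sub>R x + Im c *\<^sub>R (\<i> *\<^sub>C (x :: 'c::complex_normed_vector))"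
  by (subst complex_eq[of c])
    (simp only: scaleR_scaleC scaleC_scaleC scaleC_add_left mult.commute)

lemma scaleC_ii_scaleC_ii: "\<i> *\<^sub>C \<i> *\<^sub>C x = - (x :: 'c::complex_normed_vector)"
  using scaleR_scaleC[of "-1" x] by (simp add: scaleC_scaleC)

lemma scaleC_ii_scaleR: "\<i> *\<^sub>C (r *\<^sub>R x) = r *\<^sub>R (\<i> *\<^sub>C (x :: 'c::complex_normed_vector))"
  by (simp add: scaleR_scaleC scaleC_scaleC mult.commute)

text \<open>The only complex-linear functional with real part \<open>g\<close>: linearity forces its
  imaginary part at \<open>x\<close> to be \<open>- g (\<i> *\<^sub>C x)\<close>.\<close>

definition complexify :: "('c::complex_normed_vector \<Rightarrow>\<^sub>L real) \<Rightarrow> 'c cdual" where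
  "complexify g = CDual (\<lambda>x. Complex (blinfun_apply g x) (- blinfun_apply g (\<i> *\<^sub>C x)))"

lemma cmod_complexify_le:
  "cmod (Complex (blinfun_apply g x) (- blinfun_apply g (\<i> *\<^sub>C x))) \<le> 2 * norm g * norm x"
proof -
  have "cmod (Complex (blinfun_apply g x) (- blinfun_apply g (\<i> *\<^sub>C x)))
      \<le> \<bar>blinfun_apply g x\<bar> + \<bar>blinfun_apply g (\<i> *\<^sub>C x)\<bar>"
    using cmod_le[of "Complex (blinfun_apply g x) (- blinfun_apply g (\<i> *\<^sub>C x))"] by simp
  also have "\<dots> \<le> norm g * norm x + norm g * norm x"
    using norm_blinfun[of g x] norm_blinfun[of g "\<i> *\<^sub>C x"]
    by (intro add_mono) (simp_all add: norm_scaleC)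
  finally show ?thesis by (simp add: algebra_simps)
qed

lemma complexify_apply [simp]:
  "cdual_apply (complexify g) x = Complex (blinfun_apply g x) (- blinfun_apply g (\<i> *\<^sub>C x))"
proof -
  let ?f = "\<lambda>x. Complex (blinfun_apply g x) (- blinfun_apply g (\<i> *\<^sub>C x))"
  have "bounded_linear ?f"
    using cmod_complexify_le[of g]
    by (intro bounded_linear_intro[where K = "2 * norm g"])
      (simp_all add: complex_eq_iff blinfun.bilinear_simps scaleC_add_right scaleC_ii_scaleR mult.commute)
  moreover have "?f (c *\<^sub>C x) = c *\<^sub>C ?f x" for c x
    by (subst (1 2) scaleC_conv_scaleR)
      (simp add: complex_eq_iff scaleC_complex_def blinfun.bilinear_simps scaleC_add_right
        scaleC_ii_scaleR scaleC_ii_scaleC_ii)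
  ultimately show ?thesis
    by (simp add: complexify_def CDual_inverse bounded_clinear_def)
qed

lemma norm_complexify_le: "norm (complexify g) \<le> 2 * norm g"
  unfolding norm_cdual.rep_eq complexify_apply[abs_def]
  by (rule onorm_bound) (simp_all add: cmod_complexify_le)

lemma bounded_linear_complexify: "bounded_linear complexify"
proof (rule bounded_linear_intro)
  show "norm (complexify g) \<le> norm g * 2" for g :: "'a \<Rightarrow>\<^sub>L real"
    using norm_complexify_le[of g] by simp
qed (auto intro!: cdual_eqI simp: complex_eq_iff blinfun.bilinear_simps
    plus_cdual.rep_eq scaleR_cdual.rep_eq)

lemma re_functional_complexify [simp]: "re_functional (complexify g) = g"
  by (rule blinfun_eqI) simp

lemma complexify_re_functional [simp]: "complexify (re_functional f) = f"
  by (rule cdual_eqI) (simp add: complex_eq_iff cdual_apply_scaleC)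

text \<open>The real bidual is a continuous image of the complex one: take real parts after
  identifying real functionals with complex ones by \<open>complexify\<close>. A preimage of
  \<open>y\<close> is the complexification of \<open>y\<close> composed with
  \<open>re_functional\<close>.\<close>

lemma separable_space_real_bidual:
  assumes "separable_space (euclidean :: 'c::complex_normed_vector cdual cdual topology)"
  shows "separable_space (euclidean :: (('c \<Rightarrow>\<^sub>L real) \<Rightarrow>\<^sub>L real) topology)"
proof (rule separable_space_continuous_map_image[OF assms])
  let ?J = "\<lambda>\<Psi> :: 'c cdual cdual. re_functional \<Psi> o\<^sub>L Blinfun complexify"
  have "bounded_linear ?J"
    by (rule bounded_linear_compose[OF bounded_bilinear.bounded_linear_left
          [OF bounded_bilinear_blinfun_compose] bounded_linear_re_functional])
  then show "continuous_map euclidean euclidean ?J"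
    by (simp add: linear_continuous_on)
  have "\<exists>\<Psi>. y = ?J \<Psi>" for y :: "('c \<Rightarrow>\<^sub>L real) \<Rightarrow>\<^sub>L real"
    by (rule exI[of _ "complexify (y o\<^sub>L Blinfun re_functional)"], rule blinfun_eqI)
      (simp add: bounded_linear_Blinfun_apply bounded_linear_complexify bounded_linear_re_functional)
  then show "?J ` topspace euclidean = topspace euclidean" by auto
qed

lemma creflexive_space_if_reflexive_space:
  assumes "reflexive_space TYPE('c::complex_normed_vector)"
  shows "creflexive_space TYPE('c)"
proof -
  have "\<exists>e. \<Psi> = cbidual_embedding e" for \<Psi> :: "'c cdual cdual"
  proof -
    obtain e where e: "re_functional \<Psi> o\<^sub>L Blinfun complexify = bidual_embedding e"
      using assms unfolding reflexive_space_def by (metis surjD)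
    have Re: "Re (cdual_apply \<Psi> f) = Re (cdual_apply f e)" for f
      using arg_cong[OF e, of "\<lambda>y. blinfun_apply y (re_functional f)"]
      by (simp add: bounded_linear_Blinfun_apply bounded_linear_complexify)
    \<comment> \<open>Multiplying the functional by \<open>\<i>\<close> turns the real part into
      minus the imaginary part.\<close>
    have "Im (cdual_apply \<Psi> f) = Im (cdual_apply f e)" for f
      using Re[of "\<i> *\<^sub>C f"]
      by (simp add: cdual_apply_scaleC scaleC_cdual.rep_eq scaleC_complex_def)
    with Re have "\<Psi> = cbidual_embedding e"
      by (intro cdual_eqI) (simp add: complex_eq_iff cbidual_embedding.rep_eq)
    then show ?thesis by blast
  qed
  then show ?thesis unfolding creflexive_space_def surj_def by blast
qed

section \<open>From a complex frame to a real frame\<close>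

lemma sum_interleave:
  fixes p q :: "nat \<Rightarrow> 'a::comm_monoid_add"
  shows "(\<Sum>n<2*N. if even n then p (n div 2) else q (n div 2)) = (\<Sum>n<N. p n + q n)"
  by (induction N) (simp_all add: add_ac)

text \<open>Partial sums of even length are partial sums of the paired series. Those of odd length
  carry one unpaired term of \<open>p\<close>, which is why \<open>p\<close> has to tend to
  0.\<close>

lemma sums_interleave:
  fixes p q :: "nat \<Rightarrow> 'a::real_normed_vector"
  assumes sums: "(\<lambda>n. p n + q n) sums s" and p: "p \<longlonglongrightarrow> 0"
  shows "(\<lambda>n. if even n then p (n div 2) else q (n div 2)) sums s"
proof -
  let ?S = "\<lambda>N. \<Sum>n<N. if even n then p (n div 2) else q (n div 2)"
  have half: "filterlim (\<lambda>n::nat. n div 2) sequentially sequentially"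
    by (rule filterlim_at_top_div_const_nat) simp
  have S: "?S n = (\<Sum>k<n div 2. p k + q k) + (if even n then 0 else p (n div 2))" for n
  proof (cases "even n")
    case True
    then show ?thesis using sum_interleave[of p q "n div 2"] by simp
  next
    case False
    then obtain k where "n = Suc (2 * k)" by (metis oddE Suc_eq_plus1)
    then show ?thesis using sum_interleave[of p q k] by simp
  qed
  have "(\<lambda>n. \<Sum>k<n div 2. p k + q k) \<longlonglongrightarrow> s"
    by (rule filterlim_compose[OF _ half]) (use sums in \<open>simp add: sums_def\<close>)
  moreover have "(\<lambda>n. if even n then 0 else p (n div 2)) \<longlonglongrightarrow> 0"
    by (rule Lim_null_comparison[OF _ tendsto_norm_zero[OF filterlim_compose[OF p half]]]) simp
  ultimately show ?thesis
    unfolding sums_def S using tendsto_add by fastforce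
qed

text \<open>A term \<open>c *\<^sub>C a n\<close> splits into \<open>Re c\<close> times
  \<open>a n\<close> and \<open>Im c\<close> times \<open>\<i> *\<^sub>C a n\<close>; these go to
  the positions \<open>2 * n\<close> and \<open>2 * n + 1\<close>.\<close>

lemma real_frame_of_complex_frame:
  fixes a :: "nat \<Rightarrow> 'c::complex_banach cdual"
  assumes "cbesselian_schauder_frame a b"
  shows "\<exists>(a' :: nat \<Rightarrow> ('c \<Rightarrow>\<^sub>L real)) b'. besselian_schauder_frame a' b'"
proof -
  obtain B where B: "B > 0" and s: "\<And>x (y :: 'c cdual cdual).
      summable (\<lambda>n. cmod (cdual_apply (b n) x) * cmod (cdual_apply y (a n))) \<and>
      (\<Sum>n. cmod (cdual_apply (b n) x) * cmod (cdual_apply y (a n))) \<le> B * norm x * norm y"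
    using assms unfolding cbesselian_schauder_frame_def by blast
  have expand: "(\<lambda>n. cdual_apply (b n) x *\<^sub>C a n) sums x" for x
    using assms by (simp add: cbesselian_schauder_frame_def)
  define a' where "a' n = re_functional (if even n then a (n div 2) else \<i> *\<^sub>C a (n div 2))" for n
  \<comment> \<open>The factor \<open>- \<i>\<close> makes the real part of the new functional the
    imaginary part of the old one.\<close>
  define b' where "b' n = re_functional (if even n then b (n div 2) else (- \<i>) *\<^sub>C b (n div 2))
    o\<^sub>L Blinfun complexify" for n
  have b': "blinfun_apply (b' n) x =
      (if even n then Re (cdual_apply (b (n div 2)) (complexify x))
       else Im (cdual_apply (b (n div 2)) (complexify x)))" for n x
    by (simp add: b'_def bounded_linear_Blinfun_apply bounded_linear_complexify
        scaleC_cdual.rep_eq scaleC_complex_def)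
  have "(\<lambda>n. blinfun_apply (b' n) x *\<^sub>R a' n) sums x" for x
  proof -
    let ?c = "\<lambda>n. cdual_apply (b n) (complexify x)"
    let ?p = "\<lambda>n. Re (?c n) *\<^sub>R re_functional (a n)"
    let ?q = "\<lambda>n. Im (?c n) *\<^sub>R re_functional (\<i> *\<^sub>C a n)"
    have "(\<lambda>n. ?p n + ?q n) sums x"
      using bounded_linear.sums[OF bounded_linear_re_functional expand[of "complexify x"]]
      by (simp add: re_functional_scaleC[of "cdual_apply _ _"])
    moreover have "?p \<longlonglongrightarrow> 0"
    proof (rule Lim_null_comparison)
      show "(\<lambda>n. norm (?c n *\<^sub>C a n)) \<longlonglongrightarrow> 0"
        using expand[of "complexify x"] by (intro tendsto_norm_zero summable_LIMSEQ_zero sums_summable)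
      show "\<forall>\<^sub>F n in sequentially. norm (?p n) \<le> norm (?c n *\<^sub>C a n)"
        by (simp add: norm_scaleC mult_mono abs_Re_le_cmod norm_re_functional_le)
    qed
    ultimately have "(\<lambda>n. if even n then ?p (n div 2) else ?q (n div 2)) sums x"
      by (rule sums_interleave)
    moreover have "(\<lambda>n. blinfun_apply (b' n) x *\<^sub>R a' n) =
        (\<lambda>n. if even n then ?p (n div 2) else ?q (n div 2))"
      by (auto simp: b' a'_def)
    ultimately show ?thesis by simp
  qed
  moreover have "summable (\<lambda>n. \<bar>blinfun_apply (b' n) x\<bar> * \<bar>blinfun_apply y (a' n)\<bar>) \<and>
      (\<Sum>n. \<bar>blinfun_apply (b' n) x\<bar> * \<bar>blinfun_apply y (a' n)\<bar>) \<le> (8 * B) * norm x * norm y" for x y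
  proof -
    let ?h = "\<lambda>n. \<bar>blinfun_apply (b' n) x\<bar> * \<bar>blinfun_apply y (a' n)\<bar>"
    \<comment> \<open>The modulus of \<open>Y\<close> at \<open>a n\<close> dominates the values of
      \<open>y\<close> at both real vectors made from \<open>a n\<close>, since up to sign these are
      its real and imaginary parts.\<close>
    define Y where "Y = complexify (y o\<^sub>L Blinfun re_functional)"
    have Y: "cdual_apply Y f =
        Complex (blinfun_apply y (re_functional f)) (- blinfun_apply y (re_functional (\<i> *\<^sub>C f)))" for f
      by (simp add: Y_def bounded_linear_Blinfun_apply bounded_linear_re_functional)
    have "norm (Blinfun (re_functional :: 'c cdual \<Rightarrow> _)) \<le> 1"
      by (rule norm_blinfun_bound)
        (simp_all add: bounded_linear_Blinfun_apply bounded_linear_re_functional norm_re_functional_le)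
    then have "norm y * norm (Blinfun (re_functional :: 'c cdual \<Rightarrow> _)) \<le> norm y"
      by (simp add: mult_left_le)
    then have nY: "norm Y \<le> 2 * norm y"
      using norm_complexify_le[of "y o\<^sub>L Blinfun re_functional"]
        norm_blinfun_compose[of y "Blinfun re_functional"] by (simp add: Y_def)
    let ?k = "\<lambda>n. cmod (cdual_apply (b n) (complexify x)) * cmod (cdual_apply Y (a n))"
    \<comment> \<open>The conditional with equal branches matches the shape of
      \<open>sum_interleave\<close>.\<close>
    have le: "?h n \<le> (if even n then ?k (n div 2) else ?k (n div 2))" for n
    proof -
      have "\<bar>blinfun_apply (b' n) x\<bar> \<le> cmod (cdual_apply (b (n div 2)) (complexify x))"
        by (simp add: b' abs_Re_le_cmod abs_Im_le_cmod)
      moreover have "\<bar>blinfun_apply y (a' n)\<bar> \<le> cmod (cdual_apply Y (a (n div 2)))"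
        using abs_Re_le_cmod[of "cdual_apply Y (a (n div 2))"]
          abs_Im_le_cmod[of "cdual_apply Y (a (n div 2))"] by (simp add: Y a'_def)
      ultimately show ?thesis by (simp add: mult_mono)
    qed
    \<comment> \<open>The 8 is a product of three factors 2: each complex term is used twice, and
      \<open>complexify x\<close> and \<open>Y\<close> each cost a factor 2 in norm.\<close>
    have bound: "(\<Sum>n<N. ?h n) \<le> (8 * B) * norm x * norm y" for N
    proof -
      have "(\<Sum>n<N. ?h n) \<le> (\<Sum>n<2*N. ?h n)"
        by (rule sum_mono2) auto
      also have "\<dots> \<le> (\<Sum>n<2*N. if even n then ?k (n div 2) else ?k (n div 2))"
        by (rule sum_mono) (rule le)
      also have "\<dots> = 2 * (\<Sum>n<N. ?k n)"
        using sum_interleave[of ?k ?k N] by (simp add: sum_distrib_left mult_ac)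
      also have "\<dots> \<le> 2 * (\<Sum>n. ?k n)"
        using s[of "complexify x" Y] by (simp add: sum_le_suminf)
      also have "\<dots> \<le> 2 * (B * norm (complexify x) * norm Y)"
        using s[of "complexify x" Y] by simp
      also have "\<dots> \<le> 2 * (B * (2 * norm x) * (2 * norm y))"
        using B nY norm_complexify_le[of x] by (intro mult_left_mono mult_mono) auto
      finally show ?thesis by simp
    qed
    have summ: "summable ?h"
      by (rule summableI_nonneg_bounded[OF _ bound]) simp
    with suminf_le_const[OF this bound] show ?thesis by blast
  qed
  moreover have "8 * B > 0" using B by simp
  ultimately have "besselian_schauder_frame a' b'"
    unfolding besselian_schauder_frame_def by blast
  then show ?thesis by blast
qed

theorem corollary10:
  shows
    "((\<exists>(a :: nat \<Rightarrow> ('a::banach \<Rightarrow>\<^sub>L real)) b. besselian_schauder_frame a b) \<longrightarrow>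
       separable_space (euclidean :: (('a \<Rightarrow>\<^sub>L real) \<Rightarrow>\<^sub>L real) topology) \<longrightarrow>
       reflexive_space TYPE('a))
   \<and> ((\<exists>(a :: nat \<Rightarrow> 'b::complex_banach cdual) b. cbesselian_schauder_frame a b) \<longrightarrow>
       separable_space (euclidean :: 'b cdual cdual topology) \<longrightarrow>
       creflexive_space TYPE('b))"
  by (intro conjI impI; elim exE)
    (blast intro: dual_frame_imp_reflexive creflexive_space_if_reflexive_space
      dest: real_frame_of_complex_frame separable_space_real_bidual)+

end
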